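(* Let $\mathcal{R}$ be a TRS and let $\langle \mathcal{R},\emptyset\rangle = \langle\mathcal{S}_0,\mathcal{P}_0\rangle \leadsto \langle\mathcal{S}_1,\mathcal{P}_1\rangle \leadsto \cdots \leadsto \langle\mathcal{S}_n,\mathcal{P}_n\rangle$ be a derivation of the abstract reduction-preserving completion procedure. If $\mathcal{S}_n\cup\mathcal{P}_n$ is confluent, then $\mathcal{R}$ is confluent.
   Context: A rewrite rule $l\to r$ is a pair of terms with $l$ not a variable and every variable of $r$ occurring in $l$; a TRS is a finite set of rewrite rules, with rewrite relation $\to_{\mathcal{R}}$ (replace an instance $l\sigma$ of a left-hand side at some position by $r\sigma$). A TRS $\mathcal{P}$ is reversible if $s\to_{\mathcal{P}} t$ implies $t\stackrel{*}{\to}_{\mathcal{P}} s$. $\mathcal{R}$ is confluent if ${\stackrel{*}{\gets}}\circ{\stackrel{*}{\to}}\subseteq{\stackrel{*}{\to}}\circ{\stackrel{*}{\gets}}$ for $\to_{\mathcal{R}}$. $\stackrel{*}{\leftrightarrow}_{\mathcal{P}}$ is the equivalence closure of $\to_{\mathcal{P}}$; $\circ$ is relational composition. The abstract reduction-preserving completion procedure acts on pairs $\langle\mathcal{S},\mathcal{P}\rangle$ of TRSs with $\mathcal{P}$ reversible, and a step $\leadsto$ is one of: (Partition) $\langle\mathcal{S},\mathcal{P}\rangle\leadsto\langle\mathcal{S}',\mathcal{P}'\rangle$ if $\mathcal{S}\cup\mathcal{P}=\mathcal{S}'\cup\mathcal{P}'$ and $\mathcal{P}'$ is reversible; (Replacement)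 $\langle\mathcal{S}\cup\{l\to r\},\mathcal{P}\rangle\leadsto\langle\mathcal{S}\cup\{l\to r'\},\mathcal{P}\rangle$ if $r\stackrel{*}{\leftrightarrow}_{\mathcal{P}} r'$ (and $l\to r'$ is a rewrite rule); (Addition) $\langle\mathcal{S},\mathcal{P}\rangle\leadsto\langle\mathcal{S}\cup\{l\to r\},\mathcal{P}\rangle$ if $l \stackrel{*}{\leftrightarrow}_{\mathcal{P}}\circ\stackrel{*}{\to}_{\mathcal{S}} r$ (and $l\to r$ is a rewrite rule). *)

theory Defs
  imports "HOL-Library.Confluence"
begin

datatype ('f, 'v) trm = Var 'v | Fun 'f "('f, 'v) trm list"

text \<open>
  A signature is a set \<open>F\<close> of pairs of a function symbol and its arity.
  The terms over \<open>F\<close> are those of type \<open>('f, 'v) trm\<close> that respect it.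
\<close>

inductive_set trms :: "('f \<times> nat) set \<Rightarrow> ('f, 'v) trm set" for F where
  Var: "Var x \<in> trms F"
| Fun: "(f, length ts) \<in> F \<Longrightarrow> \<forall>t \<in> set ts. t \<in> trms F \<Longrightarrow> Fun f ts \<in> trms F"

fun vars :: "('f, 'v) trm \<Rightarrow> 'v set" where
  "vars (Var x) = {x}"
| "vars (Fun f ts) = (\<Union>t \<in> set ts. vars t)"

fun subst :: "('f, 'v) trm \<Rightarrow> ('v \<Rightarrow> ('f, 'v) trm) \<Rightarrow> ('f, 'v) trm" where
  "subst (Var x) \<sigma> = \<sigma> x"
| "subst (Fun f ts) \<sigma> = Fun f (map (\<lambda>t. subst t \<sigma>) ts)"

lemma size_nth_less [termination_simp]:
  "i < length ts \<Longrightarrow> size (ts ! i) < Suc (size_list size ts)"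
  by (metis less_Suc_eq_le nth_mem order_refl size_list_estimation')

text \<open>Positions are lists of argument indices, counted from 0; the root is \<open>[]\<close>.\<close>

fun poss :: "('f, 'v) trm \<Rightarrow> nat list set" where
  "poss (Var x) = {[]}"
| "poss (Fun f ts) = {[]} \<union> (\<Union>i \<in> {..<length ts}. (#) i ` poss (ts ! i))"

text \<open>The following two functions are meaningful only at positions of the given term.\<close>

fun subt_at :: "('f, 'v) trm \<Rightarrow> nat list \<Rightarrow> ('f, 'v) trm" where
  "subt_at t [] = t"
| "subt_at (Fun f ts) (i # p) = subt_at (ts ! i) p"
| "subt_at (Var x) (i # p) = Var x"

fun replace_at :: "('f, 'v) trm \<Rightarrow> nat list \<Rightarrow> ('f, 'v) trm \<Rightarrow> ('f, 'v) trm" where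
  "replace_at t [] u = u"
| "replace_at (Fun f ts) (i # p) u = Fun f (ts[i := replace_at (ts ! i) p u])"
| "replace_at (Var x) (i # p) u = Var x"

type_synonym ('f, 'v) rules = "(('f, 'v) trm \<times> ('f, 'v) trm) set"

definition rewrite_rule :: "('f \<times> nat) set \<Rightarrow> ('f, 'v) trm \<Rightarrow> ('f, 'v) trm \<Rightarrow> bool" where
  "rewrite_rule F l r \<longleftrightarrow>
    l \<in> trms F \<and> r \<in> trms F \<and> (\<forall>x. l \<noteq> Var x) \<and> vars r \<subseteq> vars l"

definition trs :: "('f \<times> nat) set \<Rightarrow> ('f, 'v) rules \<Rightarrow> bool" where
  "trs F R \<longleftrightarrow> finite R \<and> (\<forall>(l, r) \<in> R. rewrite_rule F l r)"

text \<open>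
  The rewrite relation lives on the terms over \<open>F\<close>: the rewritten term and the
  substitution are over \<open>F\<close>, hence so is the result if the rules in \<open>R\<close> are.
\<close>

definition rstep :: "('f \<times> nat) set \<Rightarrow> ('f, 'v) rules \<Rightarrow> ('f, 'v) trm \<Rightarrow> ('f, 'v) trm \<Rightarrow> bool" where
  "rstep F R s t \<longleftrightarrow>
    s \<in> trms F \<and>
    (\<exists>l r \<sigma> p. (l, r) \<in> R \<and> range \<sigma> \<subseteq> trms F \<and> p \<in> poss s \<and>
       subt_at s p = subst l \<sigma> \<and> t = replace_at s p (subst r \<sigma>))"

definition reversible :: "('f \<times> nat) set \<Rightarrow> ('f, 'v) rules \<Rightarrow> bool" where
  "reversible F P \<longleftrightarrow> (\<forall>s t. rstep F P s t \<longrightarrow> (rstep F P)\<^sup>*\<^sup>* t s)"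

text \<open>
  The notions of the library used below: \<open>equivclp\<close> is the equivalence closure, and
  \<open>confluentp r\<close> says that \<open>r\<inverse>\<inverse>\<^sup>*\<^sup>* OO r\<^sup>*\<^sup>*\<close> is contained in \<open>r\<^sup>*\<^sup>* OO r\<inverse>\<inverse>\<^sup>*\<^sup>*\<close>. For a
  TRS \<open>R\<close> over \<open>F\<close>, the closures of \<open>rstep F R\<close> are just equality outside the terms over \<open>F\<close>,
  so those elements of the type do not affect these notions.
\<close>

definition completion_pair :: "('f \<times> nat) set \<Rightarrow> ('f, 'v) rules \<times> ('f, 'v) rules \<Rightarrow> bool" where
  "completion_pair F = (\<lambda>(S, P). trs F S \<and> trs F P \<and> reversible F P)"

inductive completion_step ::
  "('f \<times> nat) set \<Rightarrow> ('f, 'v) rules \<times> ('f, 'v) rules \<Rightarrow> ('f, 'v) rules \<times> ('f, 'v) rules \<Rightarrow> bool"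
  for F where
  Partition:
    "completion_pair F (S, P) \<Longrightarrow> completion_pair F (S', P') \<Longrightarrow> S \<union> P = S' \<union> P' \<Longrightarrow>
     completion_step F (S, P) (S', P')"
| Replacement:
    "completion_pair F (S \<union> {(l, r)}, P) \<Longrightarrow> rewrite_rule F l r' \<Longrightarrow>
     equivclp (rstep F P) r r' \<Longrightarrow>
     completion_step F (S \<union> {(l, r)}, P) (S \<union> {(l, r')}, P)"
| Addition:
    "completion_pair F (S, P) \<Longrightarrow> rewrite_rule F l r \<Longrightarrow>
     (equivclp (rstep F P) OO (rstep F S)\<^sup>*\<^sup>*) l r \<Longrightarrow>
     completion_step F (S, P) (S \<union> {(l, r)}, P)"

end

theory Submission
  imports Defs
begin

text \<open>
  Every step of the procedure preserves the relation \<open>(rstep F (S \<union> P))\<^sup>*\<^sup>*\<close>, on which alone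
  confluence depends. Rewrite relations being closed under contexts and substitutions, it suffices
  that each rule on one side is simulated by rewriting on the other, and there reversibility turns
  conversion with \<open>P\<close> into rewriting with \<open>P\<close>.
\<close>

lemma subst_Var: "subst t Var = t"
  by (induction t) (auto simp: map_idI)

lemma subst_subst: "subst (subst t \<sigma>) \<tau> = subst t (\<lambda>x. subst (\<sigma> x) \<tau>)"
  by (induction t) auto

lemma subst_trms: "t \<in> trms F \<Longrightarrow> range \<sigma> \<subseteq> trms F \<Longrightarrow> subst t \<sigma> \<in> trms F"
  by (induction t rule: trms.induct) (auto intro!: trms.Fun)

lemma poss_subst: "p \<in> poss t \<Longrightarrow> p \<in> poss (subst t \<sigma>)"
proof (induction t p rule: subt_at.induct)
  case (1 t)
  then show ?case by (cases "subst t \<sigma>") auto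
qed auto

lemma subt_at_subst: "p \<in> poss t \<Longrightarrow> subt_at (subst t \<sigma>) p = subst (subt_at t p) \<sigma>"
  by (induction t p rule: subt_at.induct) auto

lemma replace_at_subst:
  "p \<in> poss t \<Longrightarrow> replace_at (subst t \<sigma>) p (subst u \<sigma>) = subst (replace_at t p u) \<sigma>"
  by (induction t p u rule: replace_at.induct) (auto simp: map_update)

lemma replace_at_subt_at: "p \<in> poss t \<Longrightarrow> replace_at t p (subt_at t p) = t"
  by (induction t p rule: subt_at.induct) auto

lemma Fun_trms_iff: "Fun f ts \<in> trms F \<longleftrightarrow> (f, length ts) \<in> F \<and> set ts \<subseteq> trms F"
  by (auto elim: trms.cases intro: trms.Fun)

lemma replace_at_trms: "t \<in> trms F \<Longrightarrow> u \<in> trms F \<Longrightarrow> replace_at t p u \<in> trms F"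
proof (induction t p u rule: replace_at.induct)
  case (2 f ts i p u)
  then show ?case
    \<comment> \<open>An index out of range makes \<open>list_update\<close> leave the arguments as
      they are.\<close>
    by (cases "i < length ts")
      (auto simp: Fun_trms_iff subset_iff list_update_beyond
        dest!: subsetD[OF set_update_subset_insert])
qed auto

lemma rstepI:
  assumes "(l, r) \<in> R" and "s \<in> trms F" and "range \<sigma> \<subseteq> trms F" and "p \<in> poss s"
    and "subt_at s p = subst l \<sigma>" and "t = replace_at s p (subst r \<sigma>)"
  shows "rstep F R s t"
  unfolding rstep_def using assms by blast

text \<open>The same rule applies at the same position; its matching substitution is composed with
  \<open>\<sigma>\<close>.\<close>

lemma rstep_subst:
  assumes "rstep F R s t" and \<sigma>: "range \<sigma> \<subseteq> trms F"
  shows "rstep F R (subst s \<sigma>) (subst t \<sigma>)"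
proof -
  from assms(1) obtain l r \<tau> p where s: "s \<in> trms F" and lr: "(l, r) \<in> R"
    and \<tau>: "range \<tau> \<subseteq> trms F" and p: "p \<in> poss s" and l: "subt_at s p = subst l \<tau>"
    and t: "t = replace_at s p (subst r \<tau>)"
    unfolding rstep_def by blast
  have "range (\<lambda>x. subst (\<tau> x) \<sigma>) \<subseteq> trms F"
    using \<tau> \<sigma> by (auto intro: subst_trms)
  moreover have "subt_at (subst s \<sigma>) p = subst l (\<lambda>x. subst (\<tau> x) \<sigma>)"
    by (simp add: subt_at_subst p l subst_subst)
  moreover have "subst t \<sigma> = replace_at (subst s \<sigma>) p (subst r (\<lambda>x. subst (\<tau> x) \<sigma>))"
    by (simp add: t replace_at_subst[OF p, symmetric] subst_subst)
  ultimately show ?thesis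
    unfolding rstep_def using subst_trms[OF s \<sigma>] lr poss_subst[OF p] by blast
qed

text \<open>The position of the step is prefixed with \<open>i\<close>. The shape
  \<open>ts[i := u]\<close> is the one that \<open>replace_at\<close> produces.\<close>

lemma rstep_Fun:
  assumes "rstep F R u v" and i: "i < length ts" and trm: "Fun f (ts[i := u]) \<in> trms F"
  shows "rstep F R (Fun f (ts[i := u])) (Fun f (ts[i := v]))"
proof -
  from assms(1) obtain l r \<sigma> p where "(l, r) \<in> R" "range \<sigma> \<subseteq> trms F" "p \<in> poss u"
    "subt_at u p = subst l \<sigma>" "v = replace_at u p (subst r \<sigma>)"
    unfolding rstep_def by blast
  then show ?thesis
    using trm i by (intro rstepI[where p = "i # p"]) (auto intro!: bexI[of _ i])
qed

lemma rstep_replace_at: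
  assumes "rstep F R u v" and "s \<in> trms F" and "p \<in> poss s"
  shows "rstep F R (replace_at s p u) (replace_at s p v)"
  using assms(2,3)
proof (induction s p rule: subt_at.induct)
  case (1 t)
  then show ?case using assms(1) by simp
next
  case (2 f ts i p)
  have u: "u \<in> trms F" using assms(1) by (simp add: rstep_def)
  from 2 have "rstep F R (replace_at (ts ! i) p u) (replace_at (ts ! i) p v)"
    by (auto simp: Fun_trms_iff subset_iff)
  with 2 show ?case
    \<comment> \<open>The context filled with \<open>u\<close> is a term over \<open>F\<close>, as
      \<open>rstep_Fun\<close> demands.\<close>
    using replace_at_trms[OF 2(2) u, of "i # p"] by (auto intro!: rstep_Fun)
qed auto

lemma rtranclp_rstep_subst_replace_at:
  assumes "(rstep F R)\<^sup>*\<^sup>* u v" and "range \<sigma> \<subseteq> trms F" and "s \<in> trms F" and "p \<in> poss s"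
  shows "(rstep F R)\<^sup>*\<^sup>* (replace_at s p (subst u \<sigma>)) (replace_at s p (subst v \<sigma>))"
  using assms(1)
proof (induction rule: rtranclp_induct)
  case (step v w)
  from rstep_replace_at[OF rstep_subst[OF step(2) assms(2)] assms(3,4)] step(3)
  show ?case by simp
qed simp

text \<open>A step with \<open>A\<close> is an instance of a rule placed in a context, so the
  sequence simulating that rule can be replayed there.\<close>

lemma rstep_simulation:
  assumes "\<And>l r. (l, r) \<in> A \<Longrightarrow> (rstep F B)\<^sup>*\<^sup>* l r"
  shows "(rstep F A)\<^sup>*\<^sup>* \<le> (rstep F B)\<^sup>*\<^sup>*"
proof -
  have "(rstep F B)\<^sup>*\<^sup>* s t" if "rstep F A s t" for s t
  proof -
    from that obtain l r \<sigma> p where s: "s \<in> trms F" and lr: "(l, r) \<in> A"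
      and \<sigma>: "range \<sigma> \<subseteq> trms F" and p: "p \<in> poss s" and l: "subt_at s p = subst l \<sigma>"
      and t: "t = replace_at s p (subst r \<sigma>)"
      unfolding rstep_def by blast
    show ?thesis
      \<comment> \<open>The replayed sequence starts at \<open>s\<close>, since putting
        \<open>subst l \<sigma>\<close> back at \<open>p\<close> changes nothing.\<close>
      using rtranclp_rstep_subst_replace_at[OF assms[OF lr] \<sigma> s p] t
        replace_at_subt_at[OF p] l by simp
  qed
  then have "rstep F A \<le> (rstep F B)\<^sup>*\<^sup>*" by blast
  from rtranclp_mono[OF this] show ?thesis by simp
qed

text \<open>The rule is applied at the root with the identity substitution
  \<open>Var\<close>.\<close>

lemma rstep_rule:
  assumes "(l, r) \<in> R" and "l \<in> trms F"
  shows "rstep F R l r"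
proof -
  have "[] \<in> poss l" by (cases l) auto
  then show ?thesis
    using assms
    by (intro rstepI[where \<sigma> = Var and p = "[]"]) (auto simp: subst_Var intro: trms.Var)
qed

lemma rstep_mono: "A \<subseteq> B \<Longrightarrow> rstep F A \<le> rstep F B"
  unfolding rstep_def by blast

text \<open>Each backward step in a conversion can be replaced by a forward sequence.\<close>

lemma reversible_equivclp:
  assumes "reversible F P"
  shows "equivclp (rstep F P) = (rstep F P)\<^sup>*\<^sup>*"
proof (rule antisym)
  have "symclp (rstep F P) \<le> (rstep F P)\<^sup>*\<^sup>*"
    using assms by (auto simp: reversible_def symclp_def)
  from rtranclp_mono[OF this] show "equivclp (rstep F P) \<le> (rstep F P)\<^sup>*\<^sup>*"
    by (simp add: equivclp_def)
qed (auto intro: rtranclp_into_equivclp simp: le_fun_def)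

text \<open>An equality of closures, unlike a mere transfer of confluence, chains directly along a
  derivation.\<close>

lemma completion_step_rtranclp_eq:
  assumes "completion_step F (S, P) (S', P')"
  shows "(rstep F (S \<union> P))\<^sup>*\<^sup>* = (rstep F (S' \<union> P'))\<^sup>*\<^sup>*"
  using assms
proof cases
  case Partition
  then show ?thesis by simp
next
  case (Replacement T l r r')
  let ?A = "T \<union> {(l, r)} \<union> P" and ?B = "T \<union> {(l, r')} \<union> P"
  have trms: "a \<in> trms F" if "(a, b) \<in> ?A \<union> ?B" for a b
    using that Replacement by (auto simp: completion_pair_def trs_def rewrite_rule_def)
  have P: "reversible F P" using Replacement by (simp add: completion_pair_def)
  have "equivclp (rstep F P) r' r"
    using Replacement equivclp_sym by metis
  then have rr': "(rstep F P)\<^sup>*\<^sup>* r r'" "(rstep F P)\<^sup>*\<^sup>* r' r"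
    using Replacement reversible_equivclp[OF P] by auto
  have "(rstep F P)\<^sup>*\<^sup>* \<le> (rstep F ?A)\<^sup>*\<^sup>*" "(rstep F P)\<^sup>*\<^sup>* \<le> (rstep F ?B)\<^sup>*\<^sup>*"
    by (intro rtranclp_mono rstep_mono; blast)+
  then have AB: "(rstep F ?A)\<^sup>*\<^sup>* r r'" "(rstep F ?B)\<^sup>*\<^sup>* r' r"
    using rr' by auto
  \<comment> \<open>Apply the new rule to reach \<open>r'\<close>, then return to \<open>r\<close>
    with \<open>P\<close>; the other direction is dual.\<close>
  have "(rstep F ?B)\<^sup>*\<^sup>* l r"
    by (rule converse_rtranclp_into_rtranclp[where b = r'])
      (use AB trms in \<open>auto intro!: rstep_rule\<close>)
  moreover have "(rstep F ?A)\<^sup>*\<^sup>* l r'"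
    by (rule converse_rtranclp_into_rtranclp[where b = r])
      (use AB trms in \<open>auto intro!: rstep_rule\<close>)
  \<comment> \<open>The rules of \<open>T\<close> and \<open>P\<close> are on both sides and
    simulate themselves in one step.\<close>
  ultimately have "(rstep F ?A)\<^sup>*\<^sup>* = (rstep F ?B)\<^sup>*\<^sup>*"
    by (intro antisym rstep_simulation) (use trms in \<open>auto intro: r_into_rtranclp rstep_rule\<close>)
  with Replacement show ?thesis by simp
next
  case (Addition l r)
  let ?A = "S \<union> P" and ?B = "S \<union> {(l, r)} \<union> P"
  have trms: "a \<in> trms F" if "(a, b) \<in> ?B" for a b
    using that Addition by (auto simp: completion_pair_def trs_def rewrite_rule_def)
  have P: "reversible F P" using Addition by (simp add: completion_pair_def)
  have "(rstep F P)\<^sup>*\<^sup>* \<le> (rstep F ?A)\<^sup>*\<^sup>*" "(rstep F S)\<^sup>*\<^sup>* \<le> (rstep F ?A)\<^sup>*\<^sup>*"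
    by (intro rtranclp_mono rstep_mono; blast)+
  \<comment> \<open>The conversion from \<open>l\<close> becomes rewriting with \<open>P\<close>,
    followed by rewriting with \<open>S\<close>; both are within \<open>?A\<close>.\<close>
  then have lr: "(rstep F ?A)\<^sup>*\<^sup>* l r"
    using Addition reversible_equivclp[OF P] by (auto intro: rtranclp_trans)
  \<comment> \<open>Only the added rule calls for \<open>lr\<close>; all others lie in both
    systems.\<close>
  have "(rstep F ?A)\<^sup>*\<^sup>* = (rstep F ?B)\<^sup>*\<^sup>*"
    by (intro antisym rtranclp_mono rstep_mono rstep_simulation)
      (use trms lr in \<open>auto intro: r_into_rtranclp rstep_rule\<close>)
  with Addition show ?thesis by simp
qed

theorem theorem4p5:
  fixes F :: "('f \<times> nat) set"
    and R :: "('f, 'v) rules"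
    and S P :: "nat \<Rightarrow> ('f, 'v) rules"
    and n :: nat
  assumes "trs F R"
    and "S 0 = R" and "P 0 = {}"
    and "\<And>i. i < n \<Longrightarrow> completion_step F (S i, P i) (S (Suc i), P (Suc i))"
    and "confluentp (rstep F (S n \<union> P n))"
  shows "confluentp (rstep F R)"
proof -
  have "(rstep F (S i \<union> P i))\<^sup>*\<^sup>* = (rstep F R)\<^sup>*\<^sup>*" if "i \<le> n" for i
    using that
  proof (induction i)
    case 0
    then show ?case using assms(2,3) by simp
  next
    case (Suc i)
    then show ?case using completion_step_rtranclp_eq[OF assms(4)[of i]] by simp
  qed
  from this[of n] show ?thesis
    \<comment> \<open>Once the closure of the converse is the converse of the closure, confluence
      mentions the step relation only through its closure.\<close>
    using assms(5) by (simp add: confluentp_def rtranclp_conversep)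
qed

end
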